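(* Let $N\ge1$, $a,b,m>0$ and $\gamma(v)=\frac{1}{(1+v)^m}$ for $v\ge0$. If $c<2\sqrt a$, then the system $$u_t=\Delta(\gamma(v)u)+u(a-bu),\qquad v_t=\Delta v+u-v,\qquad (x,t)\in\mathbb R^N\times[0,+\infty),$$ has no travelling wave solution $(u(x,t),v(x,t))=(U(x\cdot\xi-ct),V(x\cdot\xi-ct))$, $\xi\in S^{N-1}$, with speed $c$ connecting the constant solutions $(a/b,a/b)$ and $(0,0)$.
   Context: A travelling wave solution connecting $(a/b,a/b)$ to $(0,0)$, propagating in the direction $\xi\in S^{N-1}$ (the unit sphere of $\mathbb R^N$) with speed $c$, is a nonnegative classical solution of the form $(u,v)(x,t)=(U(x\cdot\xi-ct),V(x\cdot\xi-ct))$; equivalently, the profiles $U,V:\mathbb R\to[0,\infty)$, functions of $z=x\cdot\xi-ct$, satisfy on $\mathbb R$ $$(\gamma(V)U)''+cU'+U(a-bU)=0,\qquad V''+cV'+U-V=0\qquad\left('=\tfrac{d}{dz}\right)$$ together with $$(U(-\infty),V(-\infty))=(a/b,a/b),\qquad (U(+\infty),V(+\infty))=(0,0).$$ *)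

theory Defs
  imports "HOL-Analysis.Analysis"
begin

definition partial_deriv :: "'a::euclidean_space \<Rightarrow> ('a \<Rightarrow> real) \<Rightarrow> 'a \<Rightarrow> real" where
  "partial_deriv e f x = deriv (\<lambda>s. f (x + s *\<^sub>R e)) 0"

definition has_partial_deriv :: "'a::euclidean_space \<Rightarrow> ('a \<Rightarrow> real) \<Rightarrow> 'a \<Rightarrow> bool" where
  "has_partial_deriv e f x \<longleftrightarrow> (\<lambda>s. f (x + s *\<^sub>R e)) field_differentiable (at 0)"

definition laplacian :: "('a::euclidean_space \<Rightarrow> real) \<Rightarrow> 'a \<Rightarrow> real" where
  "laplacian f x = (\<Sum>e\<in>Basis. partial_deriv e (partial_deriv e f) x)"

text \<open>The time variable ranges over \<open>[0, \<infinity>)\<close>, so the time derivative is one-sided at \<open>t = 0\<close>.\<close>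

definition time_deriv :: "('a::euclidean_space \<Rightarrow> real \<Rightarrow> real) \<Rightarrow> 'a \<Rightarrow> real \<Rightarrow> real" where
  "time_deriv w x t = vector_derivative (w x) (at t within {0..})"

text \<open>Regularity \<open>C\<^sup>2\<^sup>,\<^sup>1(\<real>\<^sup>N \<times> [0, \<infinity>))\<close>: \<open>w\<close>, its time derivative and all its spatial partial
  derivatives up to order two exist and are jointly continuous.\<close>

definition C21 :: "('a::euclidean_space \<Rightarrow> real \<Rightarrow> real) \<Rightarrow> bool" where
  "C21 w \<longleftrightarrow>
     continuous_on (UNIV \<times> {0..}) (\<lambda>(x, t). w x t) \<and>
     (\<forall>x. \<forall>t\<ge>0. w x differentiable (at t within {0..})) \<and>
     continuous_on (UNIV \<times> {0..}) (\<lambda>(x, t). time_deriv w x t) \<and>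
     (\<forall>i\<in>Basis.
        (\<forall>x. \<forall>t\<ge>0. has_partial_deriv i (\<lambda>y. w y t) x) \<and>
        continuous_on (UNIV \<times> {0..}) (\<lambda>(x, t). partial_deriv i (\<lambda>y. w y t) x)) \<and>
     (\<forall>i\<in>Basis. \<forall>j\<in>Basis.
        (\<forall>x. \<forall>t\<ge>0. has_partial_deriv j (partial_deriv i (\<lambda>y. w y t)) x) \<and>
        continuous_on (UNIV \<times> {0..})
          (\<lambda>(x, t). partial_deriv j (partial_deriv i (\<lambda>y. w y t)) x))"

definition motility :: "real \<Rightarrow> real \<Rightarrow> real" where
  "motility m v = 1 / (1 + v) powr m"

text \<open>The motility is meant for \<open>v \<ge> 0\<close>, so nonnegativity is part of the notion of solution.
  For such \<open>v\<close> the motility is smooth, so \<open>C21 u\<close> and \<open>C21 v\<close> make the derivatives in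
  \<open>\<Delta>(\<gamma>(v) u)\<close> exist as well.\<close>

definition nonneg_classical_solution ::
  "(real \<Rightarrow> real) \<Rightarrow> real \<Rightarrow> real \<Rightarrow>
   ('a::euclidean_space \<Rightarrow> real \<Rightarrow> real) \<Rightarrow> ('a \<Rightarrow> real \<Rightarrow> real) \<Rightarrow> bool" where
  "nonneg_classical_solution \<gamma> a b u v \<longleftrightarrow>
     C21 u \<and> C21 v \<and>
     (\<forall>x. \<forall>t\<ge>0. u x t \<ge> 0 \<and> v x t \<ge> 0) \<and>
     (\<forall>x. \<forall>t\<ge>0.
        time_deriv u x t =
          laplacian (\<lambda>y. \<gamma> (v y t) * u y t) x + u x t * (a - b * u x t) \<and>
        time_deriv v x t = laplacian (\<lambda>y. v y t) x + u x t - v x t)"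

definition travelling_wave_solution ::
  "(real \<Rightarrow> real) \<Rightarrow> real \<Rightarrow> real \<Rightarrow> real \<Rightarrow> 'a::euclidean_space \<Rightarrow>
   ('a \<Rightarrow> real \<Rightarrow> real) \<Rightarrow> ('a \<Rightarrow> real \<Rightarrow> real) \<Rightarrow> bool" where
  "travelling_wave_solution \<gamma> a b c \<xi> u v \<longleftrightarrow>
     nonneg_classical_solution \<gamma> a b u v \<and>
     (\<exists>U V :: real \<Rightarrow> real.
        (\<forall>x. \<forall>t\<ge>0. u x t = U (x \<bullet> \<xi> - c * t) \<and> v x t = V (x \<bullet> \<xi> - c * t)) \<and>
        (U \<longlongrightarrow> a / b) at_bot \<and> (V \<longlongrightarrow> a / b) at_bot \<and>
        (U \<longlongrightarrow> 0) at_top \<and> (V \<longlongrightarrow> 0) at_top)"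

end

theory Submission
  imports Defs
begin

text \<open>
  At the leading edge of a wave both profiles are small, so the first component should solve
  approximately the linearisation \<open>W'' + c W' + a W = 0\<close> at the rest state. If \<open>\<bar>c\<bar> < 2 \<surd>a\<close>, its
  solutions oscillate and cannot stay positive; if \<open>c \<le> -2 \<surd>a\<close>, they grow and cannot tend to
  \<open>0\<close>. The proof makes this rigorous for the nonlinear system, treating both ranges at once.

  The right unknown is \<open>W = \<gamma>(V) U\<close>, which solves exactly the linear equation
  \<open>W'' + p W' + q W = 0\<close> with, for \<open>g = (1 + V)\<^sup>m = 1 / \<gamma>(V)\<close>,
  \<open>p = c g\<close> and \<open>q = c g' + g (a - b U)\<close>. At \<open>+\<infinity>\<close> the coefficients tend to \<open>c\<close> and \<open>a\<close>; for
  \<open>q\<close> this requires \<open>V' \<rightarrow> 0\<close>, which comes from the second equation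
  (\<open>derivative_tendsto_0\<close>). Moreover \<open>W\<close> never vanishes: a zero of the nonnegative function \<open>W\<close>
  is a double zero, which would force \<open>W = 0\<close> everywhere to its left
  (\<open>zero_Cauchy_data_backward\<close>), against the limit \<open>a / b\<close> of \<open>U\<close> at \<open>-\<infinity>\<close>.

  Hence \<open>\<phi> = W' / W\<close> is defined on the whole line and solves the Riccati equation
  \<open>\<phi>' = - (\<phi>\<^sup>2 + p \<phi> + q)\<close>. As \<open>W > 0\<close> tends to \<open>0\<close>, there are arbitrarily distant points with
  \<open>\<phi> \<le> 0\<close>. There an upper bound \<open>P\<close> for \<open>p\<close> suffices to estimate the right-hand side,
  however negative \<open>p\<close> is, and when \<open>P\<^sup>2 < 4 Q\<close> for a lower bound \<open>Q\<close> of \<open>q\<close>, the function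
  \<open>\<phi>\<close> stays nonpositive and would reach \<open>-\<infinity>\<close> in finite time
  (\<open>positive_solution_not_tendsto_0\<close>). Such \<open>P > c\<close> and \<open>Q < a\<close> exist precisely because
  \<open>c < 2 \<surd>a\<close>.
\<close>

section \<open>Second-order linear equations on the line\<close>

text \<open>The last point up to \<open>z1\<close> at which \<open>f\<close> is nonpositive cannot lie before \<open>z1\<close>, because \<open>f\<close>
  is strictly decreasing just after it.\<close>

lemma nonpos_persists:
  fixes f f' :: "real \<Rightarrow> real"
  assumes der: "\<And>z. z \<ge> z0 \<Longrightarrow> (f has_real_derivative f' z) (at z)"
    and neg: "\<And>z. z \<ge> z0 \<Longrightarrow> f z \<le> 0 \<Longrightarrow> f' z < 0"
    and "f z0 \<le> 0" and "z0 \<le> z1"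
  shows "f z1 \<le> 0"
proof (rule ccontr)
  assume pos: "\<not> f z1 \<le> 0"
  define A where "A = {z \<in> {z0..z1}. f z \<le> 0}"
  have cont: "continuous_on {z0..z1} f"
    by (rule continuous_at_imp_continuous_on) (auto intro!: DERIV_isCont der)
  have "closed A"
    unfolding A_def by (rule continuous_on_closed_Collect_le[OF cont]) auto
  moreover have "z0 \<in> A" "bdd_above A"
    using assms by (auto simp: A_def)
  ultimately have "Sup A \<in> A"
    using closed_contains_Sup[of A] by blast
  then have s: "z0 \<le> Sup A" "Sup A \<le> z1" "f (Sup A) \<le> 0"
    by (auto simp: A_def)
  with pos have "Sup A < z1"
    by (cases "Sup A = z1") auto
  from DERIV_neg_dec_right[OF der neg, OF s(1) s(1) s(3)]
  obtain d where d: "d > 0" "\<And>h. h > 0 \<Longrightarrow> h < d \<Longrightarrow> f (Sup A + h) < f (Sup A)"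
    by blast
  define h where "h = min (d / 2) (z1 - Sup A)"
  have h: "h > 0" "h < d" "h \<le> z1 - Sup A"
    using d(1) \<open>Sup A < z1\<close> by (auto simp: h_def)
  have "Sup A + h \<in> A"
    using d(2)[OF h(1,2)] s h by (auto simp: A_def)
  then have "Sup A + h \<le> Sup A"
    using \<open>bdd_above A\<close> by (rule cSup_upper)
  with h(1) show False by simp
qed

text \<open>A quantitative oscillation argument through the Riccati equation of \<open>\<phi> = W' / W\<close>. With
  \<open>\<omega>\<^sup>2 = Q - P\<^sup>2 / 4\<close>, completing the square gives \<open>\<phi>' \<le> - ((\<phi> + P/2)\<^sup>2 + \<omega>\<^sup>2)\<close> where \<open>\<phi> \<le> 0\<close>.
  So the angle \<open>arctan ((\<phi> + P/2) / \<omega>)\<close>, which is confined to an interval of length \<open>\<pi>\<close>,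
  decreases at rate at least \<open>\<omega>\<close>, which is impossible over a length \<open>\<pi> / \<omega>\<close>. Only an upper bound
  on \<open>p\<close> is assumed: if \<open>p\<close> is very negative, positive solutions do exist, but they grow, and the
  hypothesis \<open>W \<rightarrow> 0\<close> excludes them by providing a starting point with \<open>\<phi> \<le> 0\<close>.\<close>

lemma positive_solution_not_tendsto_0:
  fixes W W' p q :: "real \<Rightarrow> real"
  assumes W: "\<And>z. z \<ge> Z \<Longrightarrow> (W has_real_derivative W' z) (at z)"
    and W': "\<And>z. z \<ge> Z \<Longrightarrow> (W' has_real_derivative - p z * W' z - q z * W z) (at z)"
    and pos: "\<And>z. z \<ge> Z \<Longrightarrow> W z > 0"
    and p: "\<And>z. z \<ge> Z \<Longrightarrow> p z \<le> P" and q: "\<And>z. z \<ge> Z \<Longrightarrow> q z \<ge> Q"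
    and disc: "P\<^sup>2 < 4 * Q"
  shows "\<not> (W \<longlongrightarrow> 0) at_top"
proof
  assume lim: "(W \<longlongrightarrow> 0) at_top"
  \<comment> \<open>Otherwise \<open>W\<close> would increase from a positive value and could not tend to \<open>0\<close>.\<close>
  obtain z0 where z0: "z0 \<ge> Z" "W' z0 \<le> 0"
  proof (rule ccontr)
    assume "\<not> thesis"
    with that have inc: "W' z > 0" if "z \<ge> Z" for z
      using \<open>z \<ge> Z\<close> by (meson not_le)
    have "W z \<ge> W Z" if "z \<ge> Z" for z
      using that by (rule DERIV_nonneg_imp_nondecreasing) (meson W inc less_imp_le)
    then have "W Z \<le> 0"
      using tendsto_lowerbound[OF lim] eventually_ge_at_top[of Z]
      by (metis (mono_tags, lifting) eventually_mono trivial_limit_at_top_linorder)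
    with pos[of Z] show False by simp
  qed
  define \<phi> where "\<phi> = (\<lambda>z. W' z / W z)"
  define \<omega> where "\<omega> = sqrt (Q - P\<^sup>2 / 4)"
  have \<omega>: "\<omega> > 0" "\<omega>\<^sup>2 = Q - P\<^sup>2 / 4"
    using disc by (auto simp: \<omega>_def)
  have d\<phi>: "(\<phi> has_real_derivative - (\<phi> z)\<^sup>2 - p z * \<phi> z - q z) (at z)" if "z \<ge> Z" for z
    unfolding \<phi>_def using pos[OF that]
    by (auto intro!: derivative_eq_intros W[OF that] W'[OF that]
        simp: field_simps power2_eq_square)
  have le: "- (\<phi> z)\<^sup>2 - p z * \<phi> z - q z \<le> - ((\<phi> z + P / 2)\<^sup>2 + \<omega>\<^sup>2)"
    if "z \<ge> Z" "\<phi> z \<le> 0" for z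
  proof -
    \<comment> \<open>The sign of \<open>\<phi>\<close> reverses the inequality \<open>p \<le> P\<close>.\<close>
    have "p z * \<phi> z \<ge> P * \<phi> z"
      using p[OF that(1)] that(2) by (rule mult_right_mono_neg)
    with q[OF that(1)] show ?thesis
      unfolding \<omega>(2) by (simp add: power2_eq_square algebra_simps)
  qed
  have sq: "(x + P / 2)\<^sup>2 + \<omega>\<^sup>2 > 0" for x
    using \<omega>(1) by (simp add: add_nonneg_pos)
  have nonpos: "\<phi> z \<le> 0" if "z \<ge> z0" for z
  proof (rule nonpos_persists[OF _ _ _ that])
    show "(\<phi> has_real_derivative - (\<phi> z)\<^sup>2 - p z * \<phi> z - q z) (at z)" if "z \<ge> z0" for z
      using d\<phi> that z0 by simp
    show "- (\<phi> z)\<^sup>2 - p z * \<phi> z - q z < 0" if "z \<ge> z0" "\<phi> z \<le> 0" for z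
      using le[of z] sq[of "\<phi> z"] that z0 by simp
    show "\<phi> z0 \<le> 0"
      using z0 pos[of z0] by (simp add: \<phi>_def divide_nonpos_pos)
  qed
  define \<theta> where "\<theta> = (\<lambda>z. arctan ((\<phi> z + P / 2) / \<omega>) + \<omega> * z)"
  have "\<theta> z \<le> \<theta> z0" if "z \<ge> z0" for z
    using that
  proof (rule DERIV_nonpos_imp_nonincreasing)
    fix y assume y: "z0 \<le> y"
    let ?r = "- (\<phi> y)\<^sup>2 - p y * \<phi> y - q y"
    let ?s = "(\<phi> y + P / 2)\<^sup>2 + \<omega>\<^sup>2"
    have "(\<theta> has_real_derivative inverse (1 + ((\<phi> y + P / 2) / \<omega>)\<^sup>2) * (?r / \<omega>) + \<omega>) (at y)"
      unfolding \<theta>_def using y z0 \<omega>(1)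
      by (auto intro!: derivative_eq_intros d\<phi>)
    moreover have "inverse (1 + ((\<phi> y + P / 2) / \<omega>)\<^sup>2) * (?r / \<omega>) + \<omega> = \<omega> * (?r / ?s + 1)"
      using \<omega>(1) sq[of "\<phi> y"] 
      by (simp add: power_divide divide_simps) (simp add: algebra_simps power2_eq_square)
    moreover have "?r / ?s + 1 \<le> 0"
      using le[of y] nonpos[of y] sq[of "\<phi> y"] y z0 by (simp add: field_simps)
    ultimately show "\<exists>d. (\<theta> has_real_derivative d) (at y) \<and> d \<le> 0"
      using \<omega>(1) by (metis mult_le_0_iff less_imp_le)
  qed
  then have "\<theta> (z0 + pi / \<omega>) \<le> \<theta> z0"
    using \<omega>(1) by (meson divide_pos_pos less_add_same_cancel1 less_imp_le pi_gt_zero)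
  moreover have "\<omega> * (z0 + pi / \<omega>) = \<omega> * z0 + pi"
    using \<omega>(1) by (simp add: field_simps)
  ultimately show False
    using arctan_lbound[of "(\<phi> (z0 + pi / \<omega>) + P / 2) / \<omega>"] arctan_ubound[of "(\<phi> z0 + P / 2) / \<omega>"]
    unfolding \<theta>_def by linarith
qed

text \<open>Backward uniqueness by an energy estimate: on a compact interval the energy \<open>W\<^sup>2 + W'\<^sup>2\<close> has
  derivative at least \<open>- K\<close> times itself, so \<open>(W\<^sup>2 + W'\<^sup>2) exp (K z)\<close> is nondecreasing, and it is
  zero at the right end.\<close>

lemma zero_Cauchy_data_backward:
  fixes W W' p q :: "real \<Rightarrow> real"
  assumes W: "\<And>z. (W has_real_derivative W' z) (at z)"
    and W': "\<And>z. (W' has_real_derivative - p z * W' z - q z * W z) (at z)"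
    and p: "continuous_on UNIV p" and q: "continuous_on UNIV q"
    and zero: "W z0 = 0" "W' z0 = 0" and "z1 \<le> z0"
  shows "W z1 = 0"
proof -
  define k where "k = (\<lambda>z. 1 + 2 * \<bar>p z\<bar> + \<bar>q z\<bar>)"
  have "continuous_on {z1..z0} k"
    unfolding k_def by (intro continuous_intros continuous_on_subset[OF p] continuous_on_subset[OF q]) auto
  moreover have "{z1..z0} \<noteq> {}"
    using \<open>z1 \<le> z0\<close> by simp
  ultimately obtain x where x: "\<And>z. z \<in> {z1..z0} \<Longrightarrow> k z \<le> k x"
    using continuous_attains_sup[of "{z1..z0}" k] by blast
  define K where "K = k x"
  define E where "E = (\<lambda>z. ((W z)\<^sup>2 + (W' z)\<^sup>2) * exp (K * z))"
  have "E z1 \<le> E z0"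
    using \<open>z1 \<le> z0\<close>
  proof (rule DERIV_nonneg_imp_nondecreasing)
    fix z assume z: "z1 \<le> z" "z \<le> z0"
    let ?d = "2 * W z * W' z + 2 * W' z * (- p z * W' z - q z * W z) + K * ((W z)\<^sup>2 + (W' z)\<^sup>2)"
    have "(E has_real_derivative ?d * exp (K * z)) (at z)"
      unfolding E_def
      by (auto intro!: derivative_eq_intros W W' simp: algebra_simps)
    moreover have "?d \<ge> 0"
    proof -
      have two: "\<bar>2 * W z * W' z\<bar> \<le> (W z)\<^sup>2 + (W' z)\<^sup>2"
        using sum_squares_bound[of "\<bar>W z\<bar>" "\<bar>W' z\<bar>"] by (simp add: abs_mult)
      have "\<bar>(2 * W z * W' z) * (1 - q z)\<bar> \<le> ((W z)\<^sup>2 + (W' z)\<^sup>2) * (1 + \<bar>q z\<bar>)"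
        unfolding abs_mult[of _ "1 - q z"] by (rule mult_mono[OF two]) auto
      moreover have "p z * (W' z)\<^sup>2 \<le> \<bar>p z\<bar> * ((W z)\<^sup>2 + (W' z)\<^sup>2)"
        by (rule mult_mono) auto
      moreover have "k z * ((W z)\<^sup>2 + (W' z)\<^sup>2) \<le> K * ((W z)\<^sup>2 + (W' z)\<^sup>2)"
        using x[of z] z by (intro mult_right_mono) (auto simp: K_def)
      ultimately show ?thesis
        by (simp add: k_def algebra_simps power2_eq_square abs_le_iff)
    qed
    ultimately show "\<exists>d. (E has_real_derivative d) (at z) \<and> 0 \<le> d"
      by (metis exp_ge_zero mult_nonneg_nonneg)
  qed
  then have "(W z1)\<^sup>2 + (W' z1)\<^sup>2 \<le> 0"
    using zero by (simp add: E_def mult_le_0_iff)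
  then show ?thesis
    by (simp add: sum_power2_le_zero_iff)
qed

text \<open>Since \<open>V \<rightarrow> 0\<close>, the mean value theorem on \<open>[z, z + 1]\<close> gives a point where \<open>V'\<close> is small.
  The combination \<open>V' + c V\<close> has the small derivative \<open>h\<close>, so it hardly varies on that interval,
  and smallness of \<open>V'\<close> spreads to \<open>z\<close>. This works for either sign of \<open>c\<close>.\<close>

lemma derivative_tendsto_0:
  fixes V V' h :: "real \<Rightarrow> real"
  assumes V: "\<And>z. (V has_real_derivative V' z) (at z)"
    and V': "\<And>z. (V' has_real_derivative h z - c * V' z) (at z)"
    and lim: "(V \<longlongrightarrow> 0) at_top" and h: "(h \<longlongrightarrow> 0) at_top"
  shows "(V' \<longlongrightarrow> 0) at_top"
proof (rule tendstoI)
  fix e :: real assume "e > 0"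
  define d where "d = e / (4 + 2 * \<bar>c\<bar>)"
  have d: "d > 0"
    using \<open>e > 0\<close> by (simp add: d_def add_pos_nonneg)
  have "eventually (\<lambda>z. \<bar>V z\<bar> < d \<and> \<bar>h z\<bar> < d) at_top"
    using tendstoD[OF lim d] tendstoD[OF h d] by eventually_elim (simp add: dist_real_def)
  then obtain Z where Z: "\<And>z. z \<ge> Z \<Longrightarrow> \<bar>V z\<bar> < d" "\<And>z. z \<ge> Z \<Longrightarrow> \<bar>h z\<bar> < d"
    unfolding eventually_at_top_linorder by blast
  have "\<bar>V' z\<bar> < e" if z: "z \<ge> Z" for z
  proof -
    obtain y where y: "z < y" "y < z + 1" "V (z + 1) - V z = (z + 1 - z) * V' y"
      using MVT2[of z "z + 1" V V'] V by auto
    have dY: "((\<lambda>z. V' z + c * V z) has_real_derivative h x) (at x)" for x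
      by (auto intro!: derivative_eq_intros V V')
    obtain x where x: "z < x" "x < y"
      "(V' y + c * V y) - (V' z + c * V z) = (y - z) * h x"
      using MVT2[OF y(1) dY] by auto
    have "\<bar>(y - z) * h x\<bar> \<le> 1 * d"
      unfolding abs_mult using y(1,2) Z(2)[of x] x(1) z by (intro mult_mono) linarith+
    moreover have "\<bar>V' y\<bar> < 2 * d"
      using y(3) Z(1)[of z] Z(1)[of "z + 1"] z by simp
    moreover have "\<bar>c * (V y - V z)\<bar> \<le> \<bar>c\<bar> * (2 * d)"
      unfolding abs_mult using Z(1)[of y] Z(1)[of z] y(1) z by (intro mult_left_mono) linarith+
    moreover have "V' z = V' y + c * (V y - V z) - (y - z) * h x"
      using x(3) by (simp add: algebra_simps)
    ultimately have "\<bar>V' z\<bar> < 3 * d + \<bar>c\<bar> * (2 * d)"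
      by linarith
    also have "\<dots> \<le> d * (4 + 2 * \<bar>c\<bar>)"
      using d by (simp add: algebra_simps)
    also have "\<dots> = e"
      by (simp add: d_def add_pos_nonneg field_simps)
    finally show ?thesis .
  qed
  then show "eventually (\<lambda>z. dist (V' z) 0 < e) at_top"
    unfolding eventually_at_top_linorder by (auto simp: dist_real_def)
qed

section \<open>From the partial differential equations to the profile equations\<close>

lemma plane_wave_along_axis:
  fixes \<xi> e :: "'a::euclidean_space"
  assumes "(F has_real_derivative D) (at (x \<bullet> \<xi>))"
  shows "((\<lambda>s. F ((x + s *\<^sub>R e) \<bullet> \<xi>)) has_real_derivative (e \<bullet> \<xi>) * D) (at 0)"
proof -
  have "((\<lambda>s. x \<bullet> \<xi> + s * (e \<bullet> \<xi>)) has_real_derivative e \<bullet> \<xi>) (at 0)"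
    by (auto intro!: derivative_eq_intros)
  from DERIV_chain2[of F D "\<lambda>s. x \<bullet> \<xi> + s * (e \<bullet> \<xi>)" 0, OF _ this] assms show ?thesis
    by (simp add: inner_add_left mult.commute)
qed

lemma partial_deriv_plane_wave:
  fixes \<xi> e :: "'a::euclidean_space"
  assumes "\<And>z. (F has_real_derivative F' z) (at z)"
  shows "partial_deriv e (\<lambda>y. F (y \<bullet> \<xi>)) = (\<lambda>x. (e \<bullet> \<xi>) * F' (x \<bullet> \<xi>))"
  unfolding partial_deriv_def
  by (rule ext) (intro DERIV_imp_deriv plane_wave_along_axis assms)

text \<open>Each axis \<open>e\<close> contributes \<open>(\<xi> \<bullet> e)\<^sup>2 F''\<close>, and these weights add up to \<open>|\<xi>|\<^sup>2 = 1\<close>.\<close>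

lemma laplacian_plane_wave:
  fixes \<xi> :: "'a::euclidean_space"
  assumes F: "\<And>z. (F has_real_derivative F' z) (at z)"
    and F': "\<And>z. (F' has_real_derivative F'' z) (at z)"
    and "norm \<xi> = 1"
  shows "laplacian (\<lambda>y. F (y \<bullet> \<xi>)) x = F'' (x \<bullet> \<xi>)"
proof -
  have "partial_deriv e (partial_deriv e (\<lambda>y. F (y \<bullet> \<xi>))) x = (\<xi> \<bullet> e) * (\<xi> \<bullet> e) * F'' (x \<bullet> \<xi>)" for e
    using partial_deriv_plane_wave[of "\<lambda>z. (e \<bullet> \<xi>) * F' z" "\<lambda>z. (e \<bullet> \<xi>) * F'' z" e \<xi>]
    by (simp add: partial_deriv_plane_wave[OF F] DERIV_cmult[OF F'] inner_commute)
  then have "laplacian (\<lambda>y. F (y \<bullet> \<xi>)) x = (\<Sum>e\<in>Basis. (\<xi> \<bullet> e) * (\<xi> \<bullet> e)) * F'' (x \<bullet> \<xi>)"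
    by (simp add: laplacian_def sum_distrib_right)
  also have "(\<Sum>e\<in>Basis. (\<xi> \<bullet> e) * (\<xi> \<bullet> e)) = 1"
    using assms(3) by (simp flip: euclidean_inner add: dot_square_norm)
  finally show ?thesis by simp
qed

text \<open>Moving along an axis that is not orthogonal to \<open>\<xi>\<close> is an affine reparametrisation of the line
  on which the profile lives, so partial differentiability passes to the profile.\<close>

lemma plane_wave_profile_differentiable:
  fixes \<xi> e :: "'a::euclidean_space"
  assumes "\<And>x. has_partial_deriv e (\<lambda>y. F (y \<bullet> \<xi>)) x" and "e \<bullet> \<xi> \<noteq> 0" and "norm \<xi> = 1"
  shows "(F has_real_derivative deriv F z) (at z)"
proof -
  have "(\<lambda>s. F (z + s * (e \<bullet> \<xi>))) field_differentiable (at 0)"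
    using assms(1)[of "z *\<^sub>R \<xi>"] assms(3)
    by (simp add: has_partial_deriv_def inner_add_left dot_square_norm)
  then obtain D where D: "((\<lambda>s. F (z + s * (e \<bullet> \<xi>))) has_real_derivative D) (at 0)"
    by (auto simp: field_differentiable_def)
  have "((\<lambda>y. (y - z) / (e \<bullet> \<xi>)) has_real_derivative 1 / (e \<bullet> \<xi>)) (at z)"
    using assms(2) by (auto intro!: derivative_eq_intros)
  from DERIV_chain2[of "\<lambda>s. F (z + s * (e \<bullet> \<xi>))" D "\<lambda>y. (y - z) / (e \<bullet> \<xi>)" z, OF _ this] D
  have "(F has_real_derivative D * (1 / (e \<bullet> \<xi>))) (at z)"
    using assms(2) by simp
  then show ?thesis
    using DERIV_imp_deriv by metis
qed

text \<open>The regularity of the solution at time \<open>0\<close> alone makes the profile twice differentiable: a unit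
  vector has some nonzero coordinate, and the preceding lemma is applied to that axis, for \<open>F\<close> and
  then for \<open>F'\<close>.\<close>

lemma C21_profile:
  fixes \<xi> :: "'a::euclidean_space"
  assumes C: "C21 w" and w: "\<And>x. w x 0 = F (x \<bullet> \<xi>)" and "norm \<xi> = 1"
  shows "(F has_real_derivative deriv F z) (at z)"
    and "(deriv F has_real_derivative deriv (deriv F) z) (at z)"
proof -
  obtain e where e: "e \<in> Basis" "e \<bullet> \<xi> \<noteq> 0"
    using assms(3) euclidean_all_zero_iff[of \<xi>] by (metis inner_commute norm_zero zero_neq_one)
  have w': "(\<lambda>y. w y 0) = (\<lambda>y. F (y \<bullet> \<xi>))"
    using w by auto
  have F: "(F has_real_derivative deriv F z) (at z)" for z
    using C e plane_wave_profile_differentiable[OF _ e(2) assms(3), of F]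
    unfolding C21_def w'[symmetric] by auto
  then show "(F has_real_derivative deriv F z) (at z)" .
  have "has_partial_deriv e (partial_deriv e (\<lambda>y. w y 0)) x" for x
    using C e unfolding C21_def by auto
  then have "has_partial_deriv e (\<lambda>y. (e \<bullet> \<xi>) * deriv F (y \<bullet> \<xi>)) x" for x
    unfolding w' partial_deriv_plane_wave[OF F] .
  from plane_wave_profile_differentiable[OF this e(2) assms(3)]
  have "((\<lambda>z. (e \<bullet> \<xi>) * deriv F z) has_real_derivative deriv (\<lambda>z. (e \<bullet> \<xi>) * deriv F z) z) (at z)" .
  from DERIV_cmult[OF this, of "1 / (e \<bullet> \<xi>)"] e(2)
  show "(deriv F has_real_derivative deriv (deriv F) z) (at z)"
    by simp (metis DERIV_imp_deriv)
qed

lemma time_deriv_wave: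
  fixes \<xi> :: "'a::euclidean_space"
  assumes w: "\<And>t. t \<ge> 0 \<Longrightarrow> w x t = F (x \<bullet> \<xi> - c * t)"
    and F: "(F has_real_derivative D) (at (x \<bullet> \<xi>))"
  shows "time_deriv w x 0 = - c * D"
proof -
  have "((\<lambda>t. x \<bullet> \<xi> - c * t) has_real_derivative - c) (at 0)"
    by (auto intro!: derivative_eq_intros)
  from DERIV_chain2[of F D "\<lambda>t. x \<bullet> \<xi> - c * t" 0, OF _ this] F
  have "((\<lambda>t. F (x \<bullet> \<xi> - c * t)) has_real_derivative - c * D) (at 0 within {0..})"
    by (simp add: mult.commute has_field_derivative_at_within)
  then have "((\<lambda>t. F (x \<bullet> \<xi> - c * t)) has_vector_derivative - c * D) (at 0 within {0..})"
    by (simp add: has_real_derivative_iff_has_vector_derivative)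
  then have "(w x has_vector_derivative - c * D) (at 0 within {0..})"
    by (rule has_vector_derivative_transform[rotated 2]) (auto simp: w)
  then show ?thesis
    unfolding time_deriv_def
    by (intro vector_derivative_within) (simp_all add: at_within_Ici_at_right)
qed

section \<open>Nonexistence below the critical speed\<close>

lemma motility_has_derivative:
  assumes V: "(V has_real_derivative V') (at z)" and "V z \<ge> 0"
  shows "((\<lambda>z. motility m (V z)) has_real_derivative - m * V' * (1 + V z) powr (- m - 1)) (at z)"
proof -
  have "((\<lambda>z. (1 + V z) powr (- m)) has_real_derivative - m * V' * (1 + V z) powr (- m - 1)) (at z)"
    using assms(2) by (auto intro!: derivative_eq_intros V)
  then show ?thesis
    by (simp add: motility_def[abs_def] powr_minus_divide)
qed

text \<open>Below the critical speed, \<open>W = \<gamma>(V) U\<close> would be a positive decaying solution of a linear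
  equation whose coefficients eventually satisfy \<open>p \<le> P\<close> and \<open>q \<ge> Q\<close> with \<open>P\<^sup>2 < 4 Q\<close>, against
  \<open>positive_solution_not_tendsto_0\<close>. The two profile equations are \<open>dW'\<close> and \<open>dV'\<close>. The
  hypothesis \<open>nontrivial\<close>, a consequence of the limit of \<open>U\<close> at \<open>-\<infinity>\<close>, excludes the zero
  solution and thereby makes \<open>W\<close> positive.\<close>

lemma profile_speed_ge:
  fixes a b c m :: real and U U' V V' V'' W W' :: "real \<Rightarrow> real"
  assumes a: "a > 0"
    and nonneg: "\<And>z. U z \<ge> 0" "\<And>z. V z \<ge> 0"
    and dU: "\<And>z. (U has_real_derivative U' z) (at z)"
    and dV: "\<And>z. (V has_real_derivative V' z) (at z)"
    and dV': "\<And>z. (V' has_real_derivative V z - U z - c * V' z) (at z)"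
    and W_def: "\<And>z. W z = motility m (V z) * U z"
    and dW: "\<And>z. (W has_real_derivative W' z) (at z)"
    and dW': "\<And>z. (W' has_real_derivative - c * U' z - U z * (a - b * U z)) (at z)"
    and lim: "(U \<longlongrightarrow> 0) at_top" "(V \<longlongrightarrow> 0) at_top"
    and nontrivial: "\<And>z0. \<exists>z\<le>z0. U z > 0"
  shows "2 * sqrt a \<le> c"
proof (rule ccontr)
  assume "\<not> 2 * sqrt a \<le> c"
  then have c: "c < 2 * sqrt a" by simp
  define g where "g = (\<lambda>z. (1 + V z) powr m)"
  define g' where "g' = (\<lambda>z. m * V' z * (1 + V z) powr (m - 1))"
  define p where "p = (\<lambda>z. c * g z)"
  define q where "q = (\<lambda>z. c * g' z + g z * (a - b * U z))"
  have V1: "1 + V z > 0" for z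
    using nonneg(2)[of z] by simp
  have gpos: "g z > 0" for z
    using V1[of z] by (simp add: g_def)
  have U: "U z = g z * W z" for z
    using gpos[of z] by (simp add: W_def motility_def g_def)
  have dg: "(g has_real_derivative g' z) (at z)" for z
    unfolding g_def g'_def using V1[of z] by (auto intro!: derivative_eq_intros dV)
  have U': "U' z = g' z * W z + g z * W' z" for z
  proof (rule DERIV_unique[OF dU])
    have "((\<lambda>z. g z * W z) has_real_derivative g' z * W z + g z * W' z) (at z)"
      by (auto intro!: derivative_eq_intros dg dW)
    then show "(U has_real_derivative g' z * W z + g z * W' z) (at z)"
      by (simp flip: U)
  qed
  have dW'_lin: "(W' has_real_derivative - p z * W' z - q z * W z) (at z)" for z
  proof -
    have "- c * U' z - U z * (a - b * U z) = - p z * W' z - q z * W z"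
      by (simp add: p_def q_def U' U[of z] algebra_simps)
    with dW'[of z] show ?thesis by simp
  qed

  have cont: "continuous_on UNIV U" "continuous_on UNIV V" "continuous_on UNIV V'" "continuous_on UNIV g"
    by (auto intro!: continuous_at_imp_continuous_on DERIV_isCont dU dV dV' dg)
  have ne: "1 + V z \<noteq> 0" for z
    using V1[of z] by simp
  have "continuous_on UNIV g'"
    unfolding g'_def
    by (intro continuous_on_mult continuous_on_const continuous_on_powr continuous_on_add cont) (simp add: ne)
  then have cont_pq: "continuous_on UNIV p" "continuous_on UNIV q"
    unfolding p_def q_def
    by (intro continuous_on_mult continuous_on_const continuous_on_add continuous_on_diff cont; assumption)+

  have Wnonneg: "W z \<ge> 0" for z
    using U[of z] gpos[of z] nonneg(1)[of z] by (simp add: zero_le_mult_iff)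
  have Wpos: "W z > 0" for z
  proof (rule ccontr)
    assume "\<not> W z > 0"
    with Wnonneg[of z] have z: "W z = 0" by simp
    \<comment> \<open>A zero of a nonnegative function is a minimum.\<close>
    have "W' z = 0"
      using Wnonneg z by (intro DERIV_local_min[OF dW, of 1]) auto
    obtain y where "y \<le> z" "U y > 0"
      using nontrivial by blast
    with zero_Cauchy_data_backward[OF dW dW'_lin cont_pq z \<open>W' z = 0\<close>] U[of y]
    show False by simp
  qed

  have "((\<lambda>z. V z - U z) \<longlongrightarrow> 0) at_top"
    using tendsto_diff[OF lim(2,1)] by simp
  from derivative_tendsto_0[OF dV dV' lim(2) this]
  have V': "(V' \<longlongrightarrow> 0) at_top" .
  have "(g \<longlongrightarrow> (1 + 0) powr m) at_top"
    unfolding g_def by (intro tendsto_intros lim) auto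
  then have g: "(g \<longlongrightarrow> 1) at_top" by simp
  have "(g' \<longlongrightarrow> m * 0 * (1 + 0) powr (m - 1)) at_top"
    unfolding g'_def by (intro tendsto_intros lim V') auto
  then have g': "(g' \<longlongrightarrow> 0) at_top" by simp
  have "(p \<longlongrightarrow> c * 1) at_top" "(q \<longlongrightarrow> c * 0 + 1 * (a - b * 0)) at_top"
    unfolding p_def q_def by (intro tendsto_intros lim g g')+
  then have p: "(p \<longlongrightarrow> c) at_top" and q: "(q \<longlongrightarrow> a) at_top" by simp_all
  have "((\<lambda>z. motility m (V z)) \<longlongrightarrow> 1 / (1 + 0) powr m) at_top"
    unfolding motility_def by (intro tendsto_intros lim) auto
  from tendsto_mult[OF this lim(1)] have W: "(W \<longlongrightarrow> 0) at_top"
    by (simp add: W_def[abs_def])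

  \<comment> \<open>\<open>P\<close> is the midpoint between \<open>max c 0\<close> and \<open>2 \<surd>a\<close>: replacing \<open>c\<close> by \<open>max c 0\<close> keeps \<open>P\<close>
    nonnegative, so that \<open>P < 2 \<surd>a\<close> may be squared. \<open>Q\<close> is the midpoint between \<open>P\<^sup>2 / 4\<close> and \<open>a\<close>.\<close>
  define P where "P = (max c 0 + 2 * sqrt a) / 2"
  define Q where "Q = (P\<^sup>2 / 4 + a) / 2"
  have P: "c < P" "0 \<le> P" "P < 2 * sqrt a"
    using c a by (auto simp: P_def max_def field_simps)
  from P(2,3) have "P\<^sup>2 < (2 * sqrt a)\<^sup>2"
    by (intro power_strict_mono) auto
  then have "P\<^sup>2 < 4 * a"
    using a by (simp add: power_mult_distrib)
  then have Q: "Q < a" "P\<^sup>2 < 4 * Q"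
    by (simp_all add: Q_def)
  have "eventually (\<lambda>z. p z < P \<and> q z > Q) at_top"
    using order_tendstoD(2)[OF p P(1)] order_tendstoD(1)[OF q Q(1)] by eventually_elim simp
  then obtain Z where "\<And>z. z \<ge> Z \<Longrightarrow> p z < P" "\<And>z. z \<ge> Z \<Longrightarrow> q z > Q"
    unfolding eventually_at_top_linorder by blast
  then have "\<not> (W \<longlongrightarrow> 0) at_top"
    by (intro positive_solution_not_tendsto_0[OF dW dW'_lin Wpos _ _ Q(2), of Z]) (simp_all add: less_imp_le)
  with W show False by simp
qed

text \<open>The system at time \<open>0\<close>, read along the line \<open>z \<mapsto> z \<xi>\<close>, already contains the full profile
  equations, with the one-sided time derivative supplying the terms \<open>- c U'\<close> and \<open>- c V'\<close>.\<close>

theorem theorem2p2: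
  fixes a b m c :: real
  assumes "a > 0" and "b > 0" and "m > 0"
    and "c < 2 * sqrt a"
  shows "\<not> (\<exists>(\<xi> :: real ^ 'n) u v.
            norm \<xi> = 1 \<and> travelling_wave_solution (motility m) a b c \<xi> u v)"
proof
  assume "\<exists>(\<xi> :: real ^ 'n) u v.
            norm \<xi> = 1 \<and> travelling_wave_solution (motility m) a b c \<xi> u v"
  then obtain \<xi> :: "real ^ 'n" and u v U V where \<xi>: "norm \<xi> = 1"
    and sol: "nonneg_classical_solution (motility m) a b u v"
    and wave: "\<And>x t. t \<ge> 0 \<Longrightarrow> u x t = U (x \<bullet> \<xi> - c * t)" "\<And>x t. t \<ge> 0 \<Longrightarrow> v x t = V (x \<bullet> \<xi> - c * t)"
    and lim: "(U \<longlongrightarrow> a / b) at_bot" "(U \<longlongrightarrow> 0) at_top" "(V \<longlongrightarrow> 0) at_top"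
    unfolding travelling_wave_solution_def by blast
  have wave0: "u x 0 = U (x \<bullet> \<xi>)" "v x 0 = V (x \<bullet> \<xi>)" for x
    using wave[of 0] by simp_all
  have C: "C21 u" "C21 v"
    using sol by (auto simp: nonneg_classical_solution_def)
  note dU = C21_profile(1)[OF C(1) wave0(1) \<xi>] and dU' = C21_profile(2)[OF C(1) wave0(1) \<xi>]
    and dV = C21_profile(1)[OF C(2) wave0(2) \<xi>] and dV' = C21_profile(2)[OF C(2) wave0(2) \<xi>]
  have z: "(z *\<^sub>R \<xi>) \<bullet> \<xi> = z" for z
    using \<xi> by (simp add: dot_square_norm)
  have at0: "u x 0 \<ge> 0" "v x 0 \<ge> 0"
    "time_deriv u x 0 = laplacian (\<lambda>y. motility m (v y 0) * u y 0) x + u x 0 * (a - b * u x 0)"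
    "time_deriv v x 0 = laplacian (\<lambda>y. v y 0) x + u x 0 - v x 0" for x
    using sol by (auto simp: nonneg_classical_solution_def)
  have at: "U z \<ge> 0" "V z \<ge> 0"
    "time_deriv u (z *\<^sub>R \<xi>) 0 = laplacian (\<lambda>y. motility m (V (y \<bullet> \<xi>)) * U (y \<bullet> \<xi>)) (z *\<^sub>R \<xi>) + U z * (a - b * U z)"
    "time_deriv v (z *\<^sub>R \<xi>) 0 = laplacian (\<lambda>y. V (y \<bullet> \<xi>)) (z *\<^sub>R \<xi>) + U z - V z" for z
    using at0[of "z *\<^sub>R \<xi>"] unfolding wave0 z .
  have V1: "1 + V z > 0" for z
    using at(2)[of z] by simp
  define W where "W = (\<lambda>z. motility m (V z) * U z)"
  define W' where "W' = (\<lambda>z. - m * deriv V z * (1 + V z) powr (- m - 1) * U z + motility m (V z) * deriv U z)"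
  have dW: "(W has_real_derivative W' z) (at z)" for z
    unfolding W_def W'_def
    by (auto intro!: derivative_eq_intros motility_has_derivative dV dU at)
  have "W' field_differentiable at z" for z
    unfolding W'_def field_differentiable_def using V1[of z]
    by (auto intro!: exI derivative_eq_intros motility_has_derivative dV dV' dU dU' at)
  then have dW': "(W' has_real_derivative deriv W' z) (at z)" for z
    by (simp add: field_differentiable_derivI)
  have time: "time_deriv u (z *\<^sub>R \<xi>) 0 = - c * deriv U z" "time_deriv v (z *\<^sub>R \<xi>) 0 = - c * deriv V z" for z
    using time_deriv_wave[of u "z *\<^sub>R \<xi>" U \<xi> c, OF wave(1) dU]
      time_deriv_wave[of v "z *\<^sub>R \<xi>" V \<xi> c, OF wave(2) dV]
    unfolding z by blast+
  have space: "laplacian (\<lambda>y. motility m (V (y \<bullet> \<xi>)) * U (y \<bullet> \<xi>)) (z *\<^sub>R \<xi>) = deriv W' z"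
    "laplacian (\<lambda>y. V (y \<bullet> \<xi>)) (z *\<^sub>R \<xi>) = deriv (deriv V) z" for z
    using laplacian_plane_wave[OF dW dW' \<xi>, of "z *\<^sub>R \<xi>"]
      laplacian_plane_wave[OF dV dV' \<xi>, of "z *\<^sub>R \<xi>"]
    unfolding z by (simp_all add: W_def)
  have eqU: "deriv W' z = - c * deriv U z - U z * (a - b * U z)" for z
    using at(3)[of z] unfolding time space by simp
  have eqV: "deriv (deriv V) z = V z - U z - c * deriv V z" for z
    using at(4)[of z] unfolding time space by simp
  have "0 < a / b"
    using assms by simp
  from order_tendstoD(1)[OF lim(1) this] obtain N where N: "\<And>z. z \<le> N \<Longrightarrow> U z > 0"
    unfolding eventually_at_bot_linorder by blast
  have "2 * sqrt a \<le> c"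
  proof (rule profile_speed_ge[OF assms(1) at(1,2) dU dV _ _ dW _ lim(2,3)])
    show "(deriv V has_real_derivative V z - U z - c * deriv V z) (at z)" for z
      using dV'[of z] by (simp add: eqV)
    show "(W' has_real_derivative - c * deriv U z - U z * (a - b * U z)) (at z)" for z
      using dW'[of z] by (simp add: eqU)
    show "W z = motility m (V z) * U z" for z
      by (simp add: W_def)
    show "\<exists>z\<le>z0. U z > 0" for z0
      using N[of "min z0 N"] by (intro exI[of _ "min z0 N"]) auto
  qed
  with assms(4) show False by simp
qed

end
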